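(* Let $s_1,s_2,s_3,s_4$ be nonnegative integers such that $s_1+s_3+s_4>1$, $s_2+s_3+s_4>1$ and $w:=s_1+s_2+s_3+s_4>2$. Consider $$\zeta_{\mathfrak{so}(5)}(s_1,s_2,s_3,s_4)=\sum_{m,n=1}^\infty \frac{1}{m^{s_1}n^{s_2}(m+n)^{s_3}(m+2n)^{s_4}}.$$ If neither ($s_1=s_2=s_3=0$) nor ($s_1=s_2=s_4=0$) holds, then $\zeta_{\mathfrak{so}(5)}(s_1,s_2,s_3,s_4)$ is a finite $\mathbb{Q}$-linear combination of alternating Euler sums of weight $w$ and depth at most two. If $s_1=s_2=s_3=0$ or $s_1=s_2=s_4=0$, then $\zeta_{\mathfrak{so}(5)}(s_1,s_2,s_3,s_4)$ is a finite $\mathbb{Q}$-linear combination of alternating Euler sums of weight $w$ and depth at most two together with the Riemann zeta value $\zeta(w-1)$.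
   Context: For positive integers $t_1,\dots,t_d$ and signs $x_1,\dots,x_d\in\{1,-1\}$ with $(t_1,x_1)\neq(1,1)$, the alternating Euler sum is $$\zeta(t_1,\dots,t_d;x_1,\dots,x_d)=\sum_{m_1>m_2>\cdots>m_d\ge 1}\frac{x_1^{m_1}\cdots x_d^{m_d}}{m_1^{t_1}\cdots m_d^{t_d}};$$ its weight is $t_1+\dots+t_d$ and its depth is $d$. (When all $x_j=1$ these are the multiple zeta values; in depth one with $x_1=1$ one gets the Riemann zeta value $\zeta(t_1)$.) The series defining $\zeta_{\mathfrak{so}(5)}$ converges under the stated inequalities on $s_1,\dots,s_4$. *)

theory Defs
  imports "HOL-Analysis.Analysis"
begin

definition decreasing_indices :: "nat \<Rightarrow> nat \<Rightarrow> nat list set" where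
  "decreasing_indices d N = {ms. length ms = d \<and> sorted_wrt (>) ms \<and> set ms \<subseteq> {1..N}}"

text \<open>If \<open>t\<^sub>1 = 1\<close> and \<open>x\<^sub>1 = -1\<close> the series is only conditionally convergent, so the sum
  is the limit of the partial sums over the outermost index \<open>m\<^sub>1\<close>, not an unordered sum.\<close>

definition euler_sum :: "nat list \<Rightarrow> int list \<Rightarrow> real" where
  "euler_sum ts xs =
     lim (\<lambda>N. \<Sum>ms\<in>decreasing_indices (length ts) N.
       \<Prod>j<length ts. of_int (xs ! j) ^ (ms ! j) / real (ms ! j) ^ (ts ! j))"

definition euler_sum_index :: "nat list \<Rightarrow> int list \<Rightarrow> bool" where
  "euler_sum_index ts xs \<longleftrightarrow>
     ts \<noteq> [] \<and> length xs = length ts \<and> (\<forall>t\<in>set ts. t > 0) \<and> set xs \<subseteq> {1, -1} \<and>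
     (hd ts, hd xs) \<noteq> (1, 1)"

definition euler_sums :: "nat \<Rightarrow> nat \<Rightarrow> real set" where
  "euler_sums w D =
     {euler_sum ts xs | ts xs. euler_sum_index ts xs \<and> sum_list ts = w \<and> length ts \<le> D}"

definition zeta_so5 :: "nat \<Rightarrow> nat \<Rightarrow> nat \<Rightarrow> nat \<Rightarrow> real" where
  "zeta_so5 s1 s2 s3 s4 =
     (\<Sum>\<^sub>\<infinity>(m, n)\<in>{1..} \<times> {1..}.
       1 / (real m ^ s1 * real n ^ s2 * real (m + n) ^ s3 * real (m + 2 * n) ^ s4))"

interpretation rat_real: vector_space "\<lambda>(q :: rat) (x :: real). of_rat q * x"
  by unfold_locales (simp_all add: algebra_simps of_rat_add of_rat_mult)

end

theory Submission
  imports Defs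
begin

text \<open>Write \<open>A = m\<close>, \<open>B = n\<close>, \<open>C = m + n\<close>, \<open>D = m + 2n\<close>. The relations \<open>A + B = C\<close>,
  \<open>A + D = 2C\<close> and \<open>B + C = D\<close> give partial fraction expansions of \<open>1/(AB)\<close>, \<open>1/(AD)\<close> and
  \<open>1/(BC)\<close> with positive coefficients. They preserve the weight and the convergence conditions, and
  lead to sums involving only \<open>{A, C}\<close>, \<open>{B, D}\<close> or \<open>{C, D}\<close>. Each of these is a double sum over
  a region bounded by \<open>p = q\<close> and \<open>p = 2q\<close>, hence a combination of Euler sums once the parity
  condition coming from the factor \<open>2\<close> is expressed by signs. A sum over a power of \<open>C\<close> or of \<open>D\<close>
  alone occurs only if it is the given one; the number of pairs \<open>(m, n)\<close> with a given \<open>C\<close> or \<open>D\<close>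
  grows linearly, which produces \<open>\<zeta>(w - 1)\<close>.\<close>

section \<open>Absolutely convergent double series and their Euler sums\<close>

definition lower_pairs :: "(nat \<times> nat) set" where
  "lower_pairs = (SIGMA p:{1..}. {1..<p})"

definition double_term :: "nat \<Rightarrow> nat \<Rightarrow> int \<Rightarrow> int \<Rightarrow> nat \<times> nat \<Rightarrow> real" where
  "double_term a b x y = (\<lambda>(p, q). of_int x ^ p / real p ^ a * (of_int y ^ q / real q ^ b))"

text \<open>Bridge from unordered sums to the limit in \<open>euler_sum\<close>: an increasing
  exhaustion by finite sets eventually contains any given finite subset, so it tends to
  \<open>finite_subsets_at_top A\<close>.\<close>

lemma has_sum_imp_LIMSEQ_exhaustion:
  assumes "(f has_sum s) A" "\<And>N. finite (F N)" "\<And>N. F N \<subseteq> A" "incseq F" "A \<subseteq> (\<Union>N. F N)"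
  shows "(\<lambda>N. sum f (F N)) \<longlonglongrightarrow> s"
proof -
  have "filterlim F (finite_subsets_at_top A) sequentially"
    unfolding filterlim_finite_subsets_at_top
  proof (intro allI impI)
    fix X assume X: "finite X \<and> X \<subseteq> A"
    have "\<exists>N. X \<subseteq> F N"
      using conjunct1[OF X] conjunct2[OF X]
    proof (induction X rule: finite_induct)
      case (insert x X)
      then obtain N M where "X \<subseteq> F N" "x \<in> F M"
        using assms(5) by blast
      then have "insert x X \<subseteq> F (max N M)"
        using monoD[OF assms(4), of N "max N M"] monoD[OF assms(4), of M "max N M"] by auto
      then show ?case by blast
    qed auto
    then obtain N where "X \<subseteq> F N" by blast
    then show "\<forall>\<^sub>F n in sequentially. finite (F n) \<and> X \<subseteq> F n \<and> F n \<subseteq> A"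
      using assms(2,3) monoD[OF assms(4)]
      by (intro eventually_sequentiallyI[of N]) blast
  qed
  with assms(1) show ?thesis
    unfolding has_sum_def by (rule filterlim_compose)
qed

text \<open>Since q < p, half a power of p can be traded for half a power of q: 1/(p^2 q) is at most
  (pq)^(-3/2), whose sum factors into two convergent series. If b = 0, then a is at least 3 and one
  factor p is bounded below by q.\<close>

lemma double_term_summable:
  assumes "a \<ge> 2" "a + b \<ge> 3" "\<bar>x\<bar> = 1" "\<bar>y\<bar> = 1"
  shows "double_term a b x y summable_on lower_pairs"
proof -
  define h where "h = (\<lambda>n::nat. real n powr (-3/2))"
  have h0: "h n \<ge> 0" for n by (simp add: h_def)
  have "summable h" unfolding h_def by (subst summable_real_powr_iff) simp
  then have hs: "h summable_on UNIV"
    using h0 by (simp add: summable_on_UNIV_nonneg_real_iff)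
  then obtain H where H: "(h has_sum H) UNIV" by (auto simp: summable_on_def)
  have "(\<lambda>(p, q). h p * h q) summable_on UNIV \<times> UNIV"
    by (rule summable_on_SigmaI[where g = "\<lambda>p. h p * H"])
       (auto intro!: has_sum_cmult_right H summable_on_cmult_left hs mult_nonneg_nonneg[OF h0 h0])
  then have sm: "(\<lambda>(p, q). h p * h q) summable_on lower_pairs"
    by (rule summable_on_subset) (auto simp: lower_pairs_def)
  have "norm (double_term a b x y z) \<le> (\<lambda>(p, q). h p * h q) z" if zT: "z \<in> lower_pairs" for z
  proof -
    obtain p q where z: "z = (p, q)" "1 \<le> q" "q < p"
      using zT by (auto simp: lower_pairs_def)
    have ax: "\<bar>real_of_int x\<bar> = 1" "\<bar>real_of_int y\<bar> = 1" using assms by linarith+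
    have "norm (double_term a b x y z) = 1 / (real p ^ a * real q ^ b)"
      using z ax by (simp add: double_term_def abs_mult power_abs)
    also have "\<dots> \<le> 1 / (real p ^ 2 * real q)"
    proof (rule divide_left_mono)
      show "real p ^ 2 * real q \<le> real p ^ a * real q ^ b"
      proof (cases "b = 0")
        case True
        have "real p ^ 2 * real q \<le> real p ^ 2 * real p" using z by (intro mult_left_mono) auto
        also have "\<dots> = real p ^ 3" by (simp add: power2_eq_square power3_eq_cube)
        also have "\<dots> \<le> real p ^ a" using z assms True by (intro power_increasing) auto
        finally show ?thesis using True by simp
      next
        case False
        have "real q ^ 1 \<le> real q ^ b" using z False by (intro power_increasing) auto
        moreover have "real p ^ 2 \<le> real p ^ a" using z assms by (intro power_increasing) auto
        ultimately show ?thesis by (intro mult_mono) auto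
      qed
    qed (use z in auto)
    also have "\<dots> = (real p powr (-2) * real q powr (-1/2)) * real q powr (-1/2)"
      using z by (simp add: powr_minus powr_numeral field_simps flip: powr_add)
    also have "\<dots> = (real p powr (-2) * real q powr (1/2)) * real q powr (-3/2)"
      using z by (simp add: mult.assoc flip: powr_add)
    also have "\<dots> \<le> (real p powr (-2) * real p powr (1/2)) * real q powr (-3/2)"
      using z by (intro mult_right_mono mult_left_mono powr_mono2) auto
    also have "\<dots> = h p * h q"
      unfolding h_def by (simp flip: powr_add)
    finally show ?thesis using z by simp
  qed
  from Infinite_Sum.abs_summable_on_comparison_test'[OF sm this] show ?thesis
    by (rule abs_summable_summable)
qed

lemma decreasing_indices_1: "decreasing_indices (Suc 0) N = (\<lambda>p. [p]) ` {1..N}"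
  by (auto simp: decreasing_indices_def length_Suc_conv)

lemma decreasing_indices_2:
  "decreasing_indices (Suc (Suc 0)) N = (\<lambda>(p, q). [p, q]) ` (SIGMA p:{1..N}. {1..<p})"
  by (auto simp: decreasing_indices_def length_Suc_conv image_iff)

text \<open>Cutting off at p \<le> N gives exactly the partial sums in \<open>euler_sum\<close>, so
  summability identifies their limit with the unordered sum.\<close>

lemma double_term_has_sum:
  assumes "a \<ge> 2" "a + b \<ge> 3" "\<bar>x\<bar> = 1" "\<bar>y\<bar> = 1"
  shows "(double_term a b x y has_sum euler_sum [a, b] [x, y]) lower_pairs"
proof -
  obtain s where s: "(double_term a b x y has_sum s) lower_pairs"
    using double_term_summable[OF assms] by (auto simp: summable_on_def)
  have "(\<lambda>N. sum (double_term a b x y) (SIGMA p:{1..N}. {1..<p})) \<longlonglongrightarrow> s"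
    by (rule has_sum_imp_LIMSEQ_exhaustion[OF s]) (auto simp: lower_pairs_def incseq_def)
  moreover have "(\<Sum>ms\<in>decreasing_indices (length [a, b]) N.
       \<Prod>j<length [a, b]. of_int ([x, y] ! j) ^ (ms ! j) / real (ms ! j) ^ ([a, b] ! j)) =
     sum (double_term a b x y) (SIGMA p:{1..N}. {1..<p})" for N
    by (simp add: decreasing_indices_2 sum.reindex inj_on_def double_term_def lessThan_Suc
          case_prod_unfold mult.commute)
  ultimately have "euler_sum [a, b] [x, y] = s"
    unfolding euler_sum_def by (simp only: limI)
  with s show ?thesis by simp
qed

lemma single_term_has_sum:
  assumes "a \<ge> 2" "\<bar>x\<bar> = 1"
  shows "((\<lambda>p. of_int x ^ p / real p ^ a) has_sum euler_sum [a] [x]) {1..}"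
proof -
  have "summable (\<lambda>p. norm (of_int x ^ p / real p ^ a :: real))"
    using inverse_power_summable[of a, where 'a = real] assms
    by (simp add: power_abs field_simps flip: of_int_abs)
  then have "(\<lambda>p. of_int x ^ p / real p ^ a :: real) summable_on UNIV"
    by (rule norm_summable_imp_summable_on)
  then have "(\<lambda>p. of_int x ^ p / real p ^ a :: real) summable_on {1..}"
    by (rule summable_on_subset) auto
  then obtain s where s: "((\<lambda>p. of_int x ^ p / real p ^ a) has_sum s) {1..}"
    by (auto simp: summable_on_def)
  have "(\<lambda>N. sum (\<lambda>p. of_int x ^ p / real p ^ a) {1..N}) \<longlonglongrightarrow> s"
    by (rule has_sum_imp_LIMSEQ_exhaustion[OF s]) (auto simp: incseq_def)
  moreover have "(\<Sum>ms\<in>decreasing_indices (length [a]) N.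
       \<Prod>j<length [a]. of_int ([x] ! j) ^ (ms ! j) / real (ms ! j) ^ ([a] ! j)) =
     sum (\<lambda>p. of_int x ^ p / real p ^ a) {1..N}" for N
    by (simp add: decreasing_indices_1 sum.reindex inj_on_def lessThan_Suc)
  ultimately have "euler_sum [a] [x] = s"
    unfolding euler_sum_def by (simp only: limI)
  with s show ?thesis by simp
qed

section \<open>Closure properties of sums with value in a rational span\<close>

text \<open>Convergence is part of the predicate, so series can be split, recombined and reindexed
  without separate summability proofs.\<close>

definition has_sum_in_span :: "real set \<Rightarrow> ('a \<Rightarrow> real) \<Rightarrow> 'a set \<Rightarrow> bool" where
  "has_sum_in_span X f A \<longleftrightarrow> (\<exists>v\<in>rat_real.span X. (f has_sum v) A)"

lemma has_sum_in_span_cong: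
  assumes "\<And>z. z \<in> A \<Longrightarrow> f z = g z"
  shows "has_sum_in_span X f A \<longleftrightarrow> has_sum_in_span X g A"
  using assms unfolding has_sum_in_span_def by (simp cong: has_sum_cong)

lemma has_sum_in_span_base:
  "(f has_sum v) A \<Longrightarrow> v \<in> X \<Longrightarrow> has_sum_in_span X f A"
  unfolding has_sum_in_span_def by (auto intro: rat_real.span_base)

lemma has_sum_in_span_add:
  "has_sum_in_span X f A \<Longrightarrow> has_sum_in_span X g A \<Longrightarrow> has_sum_in_span X (\<lambda>z. f z + g z) A"
  unfolding has_sum_in_span_def by (blast intro: has_sum_add rat_real.span_add)

lemma has_sum_in_span_cmult:
  assumes "c \<in> \<rat>" "has_sum_in_span X f A"
  shows "has_sum_in_span X (\<lambda>z. c * f z) A"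
proof -
  from assms(1) obtain q where "c = of_rat q" by (elim Rats_cases)
  with assms(2) show ?thesis
    unfolding has_sum_in_span_def by (auto dest: has_sum_cmult_right rat_real.span_scale)
qed

lemma has_sum_in_span_Diff:
  assumes "has_sum_in_span X f A" "has_sum_in_span X f B" "B \<subseteq> A"
  shows "has_sum_in_span X f (A - B)"
  using assms unfolding has_sum_in_span_def by (blast intro: has_sum_Diff rat_real.span_diff)

lemma has_sum_in_span_Un:
  assumes "has_sum_in_span X f A" "has_sum_in_span X f B" "A \<inter> B = {}"
  shows "has_sum_in_span X f (A \<union> B)"
  using assms unfolding has_sum_in_span_def by (blast intro: has_sum_Un_disjoint rat_real.span_add)

lemma has_sum_in_span_cong_neutral:
  assumes "\<And>z. z \<in> B - A \<Longrightarrow> g z = 0" "\<And>z. z \<in> A - B \<Longrightarrow> f z = 0"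
    "\<And>z. z \<in> A \<inter> B \<Longrightarrow> f z = g z"
  shows "has_sum_in_span X f A \<longleftrightarrow> has_sum_in_span X g B"
  unfolding has_sum_in_span_def using has_sum_cong_neutral[of B A g f] assms by blast

lemma has_sum_in_span_reindex_bij_witness:
  assumes "\<And>a. a \<in> S \<Longrightarrow> i (j a) = a" "\<And>a. a \<in> S \<Longrightarrow> j a \<in> T"
    "\<And>b. b \<in> T \<Longrightarrow> j (i b) = b" "\<And>b. b \<in> T \<Longrightarrow> i b \<in> S"
    "\<And>a. a \<in> S \<Longrightarrow> h (j a) = g a"
  shows "has_sum_in_span X g S \<longleftrightarrow> has_sum_in_span X h T"
  unfolding has_sum_in_span_def
  using has_sum_reindex_bij_witness[of S i j T h g, OF assms] by simp

text \<open>With b positive, \<open>[a, b]\<close> is an admissible index of depth two; exponent 0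
  leaves the Euler sums and is treated separately below.\<close>

lemma has_sum_in_span_double_term:
  assumes "a \<ge> 2" "b \<ge> 1" "x \<in> {1, -1}" "y \<in> {1, -1}"
  shows "has_sum_in_span (euler_sums (a + b) 2) (double_term a b x y) lower_pairs"
proof (rule has_sum_in_span_base[OF double_term_has_sum])
  have "euler_sum_index [a, b] [x, y]"
    using assms by (auto simp: euler_sum_index_def)
  then show "euler_sum [a, b] [x, y] \<in> euler_sums (a + b) 2"
    unfolding euler_sums_def by force
qed (use assms in auto)

lemma has_sum_in_span_single_term:
  assumes "a \<ge> 2" "x \<in> {1, -1}"
  shows "has_sum_in_span (euler_sums a 2) (\<lambda>p. of_int x ^ p / real p ^ a) {1..}"
proof (rule has_sum_in_span_base[OF single_term_has_sum])
  have "euler_sum_index [a] [x]"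
    using assms by (auto simp: euler_sum_index_def)
  then show "euler_sum [a] [x] \<in> euler_sums a 2"
    unfolding euler_sums_def by force
qed (use assms in auto)


section \<open>Parity conditions, and double series with second exponent zero\<close>

lemma has_sum_in_span_mono:
  "has_sum_in_span X f A \<Longrightarrow> X \<subseteq> Y \<Longrightarrow> has_sum_in_span Y f A"
  unfolding has_sum_in_span_def using rat_real.span_mono by blast

text \<open>The indicator of even q is (1 + (-1)^q)/2; this is how signs enter.\<close>

lemma has_sum_in_span_even_snd:
  assumes "has_sum_in_span X (double_term a b 1 1) lower_pairs"
    "has_sum_in_span X (double_term a b 1 (-1)) lower_pairs"
  shows "has_sum_in_span X (double_term a b 1 1) {(p, q) \<in> lower_pairs. even q}"
proof -
  have "has_sum_in_span X (\<lambda>z. 1/2 * double_term a b 1 1 z +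
      1/2 * double_term a b 1 (-1) z) lower_pairs"
    by (intro has_sum_in_span_add has_sum_in_span_cmult assms) auto
  then show ?thesis
    by (rule has_sum_in_span_cong_neutral[THEN iffD1, rotated -1])
       (auto simp: double_term_def minus_one_power_iff split: if_splits)
qed

lemma has_sum_in_span_even_fst:
  assumes "has_sum_in_span X (double_term a b 1 1) lower_pairs"
    "has_sum_in_span X (double_term a b (-1) 1) lower_pairs"
  shows "has_sum_in_span X (double_term a b 1 1) {(p, q) \<in> lower_pairs. even p}"
proof -
  have "has_sum_in_span X (\<lambda>z. 1/2 * double_term a b 1 1 z +
      1/2 * double_term a b (-1) 1 z) lower_pairs"
    by (intro has_sum_in_span_add has_sum_in_span_cmult assms) auto
  then show ?thesis
    by (rule has_sum_in_span_cong_neutral[THEN iffD1, rotated -1])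
       (auto simp: double_term_def minus_one_power_iff split: if_splits)
qed

text \<open>Summability of the double series is already known, so its value may be computed by
  summing over q first. This serves the case b = 0, where the inner sum has a closed form.\<close>

lemma has_sum_in_span_double_term_iterated:
  assumes "a \<ge> 2" "a + b \<ge> 3" "\<bar>x\<bar> = 1" "\<bar>y\<bar> = 1"
    and "has_sum_in_span X (\<lambda>p. \<Sum>q\<in>{1..<p}. double_term a b x y (p, q)) {1..}"
  shows "has_sum_in_span X (double_term a b x y) lower_pairs"
proof -
  obtain v where v: "v \<in> rat_real.span X"
      "((\<lambda>p. \<Sum>q\<in>{1..<p}. double_term a b x y (p, q)) has_sum v) {1..}"
    using assms(5) by (auto simp: has_sum_in_span_def)
  have "(double_term a b x y has_sum v) lower_pairs"
    unfolding lower_pairs_def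
    by (rule has_sum_SigmaI[OF _ v(2)])
       (use double_term_summable[OF assms(1-4)] in \<open>auto simp: lower_pairs_def\<close>)
  with v(1) show ?thesis by (auto simp: has_sum_in_span_def)
qed

text \<open>The inner sum counts p - 1 values of q, so the value is \<zeta>(w - 1) -
  \<zeta>(w).\<close>

lemma has_sum_in_span_double_term_0:
  assumes "w \<ge> 3"
  shows "has_sum_in_span (insert (euler_sum [w - 1] [1]) (euler_sums w 2))
    (double_term w 0 1 1) lower_pairs"
    (is "has_sum_in_span ?X _ _")
proof (rule has_sum_in_span_double_term_iterated)
  have "has_sum_in_span ?X (\<lambda>p. of_int 1 ^ p / real p ^ (w - 1)) {1..}"
    using assms by (intro has_sum_in_span_base[OF single_term_has_sum]) auto
  moreover have "has_sum_in_span ?X (\<lambda>p. of_int 1 ^ p / real p ^ w) {1..}"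
    using assms by (intro has_sum_in_span_mono[OF has_sum_in_span_single_term]) auto
  ultimately have "has_sum_in_span ?X
      (\<lambda>p. of_int 1 ^ p / real p ^ (w - 1) + (-1) * (of_int 1 ^ p / real p ^ w)) {1..}"
    by (intro has_sum_in_span_add has_sum_in_span_cmult) auto
  moreover have "real (p - 1) / real p ^ w = 1 / real p ^ (w - 1) - 1 / real p ^ w" if "p \<ge> 1" for p
  proof -
    have "real p ^ w = real p * real p ^ (w - 1)"
      using assms by (simp flip: power_Suc)
    with that show ?thesis by (simp add: of_nat_diff diff_divide_distrib)
  qed
  ultimately show "has_sum_in_span ?X (\<lambda>p. \<Sum>q\<in>{1..<p}. double_term w 0 1 1 (p, q)) {1..}"
    by (subst has_sum_in_span_cong) (auto simp: double_term_def)
qed (use assms in auto)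

lemma sum_alternating: "(\<Sum>q\<in>{1..<Suc p}. (-1) ^ q :: real) = ((-1) ^ p - 1) / 2"
  by (induction p) auto

text \<open>The inner sum of (-1)^q over q < p is -1 for even p and 0 for odd p. It does not grow
  with p, so only depth one sums of weight w arise.\<close>

lemma has_sum_in_span_double_term_0_alternating:
  assumes "w \<ge> 3"
  shows "has_sum_in_span (euler_sums w 2) (double_term w 0 1 (-1)) lower_pairs"
    (is "has_sum_in_span ?X _ _")
proof (rule has_sum_in_span_double_term_iterated)
  have "has_sum_in_span ?X (\<lambda>p. (-1/2) * (of_int (-1) ^ p / real p ^ w) +
      (-1/2) * (of_int 1 ^ p / real p ^ w)) {1..}"
    using assms by (intro has_sum_in_span_add has_sum_in_span_cmult has_sum_in_span_single_term) auto
  moreover have "(\<Sum>q\<in>{1..<p}. double_term w 0 1 (-1) (p, q)) =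
      (-1/2) * (of_int (-1) ^ p / real p ^ w) + (-1/2) * (of_int 1 ^ p / real p ^ w)" if "p \<in> {1..}" for p
  proof -
    from that obtain k where k: "p = Suc k" by (cases p) auto
    have "(\<Sum>q\<in>{1..<p}. double_term w 0 1 (-1) (p, q)) = 1 / real p ^ w * (\<Sum>q\<in>{1..<p}. (-1) ^ q)"
      by (simp add: double_term_def flip: sum_divide_distrib)
    also have "\<dots> = 1 / real p ^ w * (((-1) ^ k - 1) / 2)"
      unfolding k by (simp only: sum_alternating)
    finally show ?thesis unfolding k by (simp add: diff_divide_distrib)
  qed
  ultimately show "has_sum_in_span ?X (\<lambda>p. \<Sum>q\<in>{1..<p}. double_term w 0 1 (-1) (p, q)) {1..}"
    by (subst has_sum_in_span_cong) auto
qed (use assms in auto)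

section \<open>Sums involving only two of the four linear forms\<close>

definition so5_term :: "nat \<Rightarrow> nat \<Rightarrow> nat \<Rightarrow> nat \<Rightarrow> nat \<times> nat \<Rightarrow> real" where
  "so5_term a b c d =
     (\<lambda>(m, n). 1 / (real m ^ a * real n ^ b * real (m + n) ^ c * real (m + 2 * n) ^ d))"

definition so5_in_span :: "real set \<Rightarrow> nat \<Rightarrow> nat \<Rightarrow> nat \<Rightarrow> nat \<Rightarrow> bool" where
  "so5_in_span X a b c d \<longleftrightarrow> has_sum_in_span X (so5_term a b c d) ({1..} \<times> {1..})"

lemma so5_in_span_imp_zeta_so5:
  assumes "so5_in_span X a b c d"
  shows "zeta_so5 a b c d \<in> rat_real.span X"
  using assms unfolding so5_in_span_def has_sum_in_span_def zeta_so5_def so5_term_def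
  by (auto dest: infsumI)

lemma so5_in_span_13:
  assumes "has_sum_in_span X (double_term c a 1 1) lower_pairs"
  shows "so5_in_span X a 0 c 0"
  unfolding so5_in_span_def
  by (subst has_sum_in_span_reindex_bij_witness[where j = "\<lambda>(m, n). (m + n, m)"
        and i = "\<lambda>(p, q). (q, p - q)" and T = lower_pairs and h = "double_term c a 1 1"])
     (use assms in \<open>auto simp: lower_pairs_def double_term_def so5_term_def mult.commute\<close>)

text \<open>The choice q = 2n, p = m + 2n gives the region q < p with q even. The factor
  \<open>2 ^ b\<close> corrects 1/q^b to 1/n^b, and the parity of q calls for the alternating
  series.\<close>

lemma so5_in_span_24:
  assumes "has_sum_in_span X (double_term d b 1 1) lower_pairs"
    "has_sum_in_span X (double_term d b 1 (-1)) lower_pairs"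
  shows "so5_in_span X 0 b 0 d"
proof -
  have "has_sum_in_span X (\<lambda>z. 2 ^ b * double_term d b 1 1 z) {(p, q) \<in> lower_pairs. even q}"
    by (intro has_sum_in_span_cmult has_sum_in_span_even_snd assms) auto
  then show ?thesis
    unfolding so5_in_span_def
    by (subst has_sum_in_span_reindex_bij_witness[where j = "\<lambda>(m, n). (m + 2 * n, 2 * n)"
          and i = "\<lambda>(p, q). (p - q, q div 2)" and T = "{(p, q) \<in> lower_pairs. even q}"])
       (auto simp: lower_pairs_def double_term_def so5_term_def power_mult_distrib)
qed

text \<open>With \<open>p = m + n\<close> and \<open>q = m + 2n\<close> the sum runs over \<open>p < q < 2p\<close>. If \<open>d \<ge> 2\<close>, this region
  is what remains of \<open>p < q\<close> after removing \<open>q = 2p\<close> and \<open>q > 2p\<close>; if \<open>c \<ge> 2\<close>, it is what remains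
  of \<open>q < 2p\<close> after removing \<open>q = p\<close> and \<open>q < p\<close>.\<close>

lemma so5_in_span_34:
  assumes "c \<ge> 1" "d \<ge> 1" "c + d \<ge> 3"
  shows "so5_in_span (euler_sums (c + d) 2) 0 0 c d"
proof (cases "d \<ge> 2")
  case True
  let ?X = "euler_sums (c + d) 2" and ?f = "double_term d c 1 1"
  have dbl: "has_sum_in_span ?X (double_term d c 1 y) lower_pairs" if "y \<in> {1, -1}" for y
    using has_sum_in_span_double_term[of d c 1 y] that True assms by (simp add: add.commute)
  have "so5_in_span ?X 0 c 0 d"
    by (intro so5_in_span_24 dbl) auto
  \<comment> \<open>Here the larger coordinate q comes first. On q > 2p, putting m = q - 2p and n =
    p turns p into B and q into D, which is the case just settled.\<close>
  then have gt: "has_sum_in_span ?X ?f {(q, p) \<in> lower_pairs. q > 2 * p}"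
    unfolding so5_in_span_def
    by (subst has_sum_in_span_reindex_bij_witness[where i = "\<lambda>(m, n). (m + 2 * n, n)"
          and j = "\<lambda>(q, p). (q - 2 * p, p)" and T = "{1..} \<times> {1..}" and h = "so5_term 0 c 0 d"])
       (auto simp: lower_pairs_def double_term_def so5_term_def of_nat_diff)
  have "has_sum_in_span ?X (\<lambda>p. (1 / 2 ^ d) * (of_int 1 ^ p / real p ^ (c + d))) {1..}"
    using assms by (intro has_sum_in_span_cmult has_sum_in_span_single_term) auto
  then have eq: "has_sum_in_span ?X ?f {(q, p) \<in> lower_pairs. q = 2 * p}"
    by (subst has_sum_in_span_reindex_bij_witness[where i = "\<lambda>p. (2 * p, p)" and j = snd
          and T = "{1..}" and h = "\<lambda>p. (1 / 2 ^ d) * (of_int 1 ^ p / real p ^ (c + d))"])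
       (auto simp: lower_pairs_def double_term_def power_add power_mult_distrib)
  have "has_sum_in_span ?X ?f (lower_pairs -
     ({(q, p) \<in> lower_pairs. q = 2 * p} \<union> {(q, p) \<in> lower_pairs. q > 2 * p}))"
    by (intro has_sum_in_span_Diff has_sum_in_span_Un dbl eq gt) auto
  then show ?thesis
    unfolding so5_in_span_def
    by (subst has_sum_in_span_reindex_bij_witness[where j = "\<lambda>(m, n). (m + 2 * n, m + n)"
          and i = "\<lambda>(q, p). (2 * p - q, q - p)" and h = ?f])
       (auto simp: lower_pairs_def double_term_def so5_term_def)
next
  case False
  \<comment> \<open>Now d = 1, so the sum over all q > p diverges and the region has to be cut out
    of q < 2p instead.\<close>
  then have c: "c \<ge> 2" using assms by simp
  let ?X = "euler_sums (c + d) 2"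
  define f where "f = (\<lambda>(p, q). 1 / (real p ^ c * real q ^ d))"
  have dbl: "has_sum_in_span ?X (double_term c d x 1) lower_pairs" if "x \<in> {1, -1}" for x
    using has_sum_in_span_double_term[of c d x 1] that c assms by simp
  have lt: "has_sum_in_span ?X f lower_pairs"
    using dbl[of 1] by (subst has_sum_in_span_cong[where g = "double_term c d 1 1"])
      (auto simp: f_def double_term_def)
  have "has_sum_in_span ?X (\<lambda>p. of_int 1 ^ p / real p ^ (c + d)) {1..}"
    using assms by (intro has_sum_in_span_single_term) auto
  then have eq: "has_sum_in_span ?X f {(p, q). p \<ge> 1 \<and> p = q}"
    by (subst has_sum_in_span_reindex_bij_witness[where i = "\<lambda>p. (p, p)" and j = fst
          and T = "{1..}" and h = "\<lambda>p. of_int 1 ^ p / real p ^ (c + d)"])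
       (auto simp: f_def power_add)
  \<comment> \<open>Replacing p by 2p turns q < 2p into \<open>lower_pairs\<close> with even first
    entry; \<open>2 ^ c\<close> compensates for the doubled denominator.\<close>
  have "has_sum_in_span ?X (\<lambda>z. 2 ^ c * double_term c d 1 1 z) {(p, q) \<in> lower_pairs. even p}"
    by (intro has_sum_in_span_cmult has_sum_in_span_even_fst dbl) auto
  then have "has_sum_in_span ?X f {(p, q). 1 \<le> q \<and> q < 2 * p}"
    by (subst has_sum_in_span_reindex_bij_witness[where i = "\<lambda>(p, q). (p div 2, q)"
          and j = "\<lambda>(p, q). (2 * p, q)" and T = "{(p, q) \<in> lower_pairs. even p}"])
       (auto simp: lower_pairs_def f_def double_term_def power_mult_distrib)
  then have "has_sum_in_span ?X f ({(p, q). 1 \<le> q \<and> q < 2 * p} -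
     ({(p, q). p \<ge> 1 \<and> p = q} \<union> lower_pairs))"
    by (intro has_sum_in_span_Diff has_sum_in_span_Un eq lt) (auto simp: lower_pairs_def)
  then show ?thesis
    unfolding so5_in_span_def
    by (subst has_sum_in_span_reindex_bij_witness[where j = "\<lambda>(m, n). (m + n, m + 2 * n)"
          and i = "\<lambda>(p, q). (2 * p - q, q - p)" and h = f])
       (auto simp: lower_pairs_def f_def so5_term_def)
qed

section \<open>Partial fractions and reduction to two linear forms\<close>

lemma so5_term_Suc:
  "so5_term (Suc a) b c d (m, n) = so5_term a b c d (m, n) / real m"
  "so5_term a (Suc b) c d (m, n) = so5_term a b c d (m, n) / real n"
  "so5_term a b (Suc c) d (m, n) = so5_term a b c d (m, n) / (real m + real n)"
  "so5_term a b c (Suc d) (m, n) = so5_term a b c d (m, n) / (real m + 2 * real n)"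
  by (simp_all add: so5_term_def mult_ac)

text \<open>One identity for all three linear relations: k = 1/2 for A + D = 2C and k = 1 for the
  other two. The numerator t carries the remaining factors.\<close>

lemma partial_fraction:
  fixes x y z t k :: real
  assumes "x > 0" "y > 0" "z > 0" "z = k * (x + y)"
  shows "t / x / y = k * (t / y / z + t / x / z)"
proof -
  have "k * (t / y / z + t / x / z) = t * (k * (x + y)) / (x * y * z)"
    using assms(1-3) by (simp add: field_simps)
  also have "\<dots> = t / x / y"
    using assms(1-3) unfolding assms(4)[symmetric] by simp
  finally show ?thesis ..
qed

lemma so5_term_reduce_14:
  assumes "m \<ge> 1" "n \<ge> 1"
  shows "so5_term (Suc a) b c (Suc d) (m, n) =
    1 / 2 * (so5_term a b (Suc c) (Suc d) (m, n) + so5_term (Suc a) b (Suc c) d (m, n))"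
  using partial_fraction[of "real m" "real m + 2 * real n" "real m + real n" "1 / 2"
      "so5_term a b c d (m, n)"] assms
  by (simp add: so5_term_Suc mult_ac)

lemma so5_term_reduce_23:
  assumes "m \<ge> 1" "n \<ge> 1"
  shows "so5_term a (Suc b) (Suc c) d (m, n) =
    1 * (so5_term a b (Suc c) (Suc d) (m, n) + so5_term a (Suc b) c (Suc d) (m, n))"
  using partial_fraction[of "real n" "real m + real n" "real m + 2 * real n" "1"
      "so5_term a b c d (m, n)"] assms
  by (simp add: so5_term_Suc mult_ac)

lemma so5_term_reduce_12:
  assumes "m \<ge> 1" "n \<ge> 1"
  shows "so5_term (Suc a) (Suc b) c d (m, n) =
    1 * (so5_term a (Suc b) (Suc c) d (m, n) + so5_term (Suc a) b (Suc c) d (m, n))"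
  using partial_fraction[of "real m" "real n" "real m + real n" "1"
      "so5_term a b c d (m, n)"] assms
  by (simp add: so5_term_Suc mult_ac)

lemma so5_in_span_combine:
  assumes "so5_in_span X a b c d" "so5_in_span X a' b' c' d'" "k \<in> \<rat>"
    and "\<And>m n. m \<ge> 1 \<Longrightarrow> n \<ge> 1 \<Longrightarrow> so5_term a'' b'' c'' d'' (m, n) =
      k * (so5_term a b c d (m, n) + so5_term a' b' c' d' (m, n))"
  shows "so5_in_span X a'' b'' c'' d''"
proof -
  have "has_sum_in_span X (\<lambda>z. k * (so5_term a b c d z + so5_term a' b' c' d' z)) ({1..} \<times> {1..})"
    using assms(1-3) unfolding so5_in_span_def
    by (intro has_sum_in_span_add has_sum_in_span_cmult) auto
  then show ?thesis
    unfolding so5_in_span_def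
    by (subst has_sum_in_span_cong) (auto simp: assms(4))
qed

text \<open>Each use of A + D = 2C moves one unit of exponent from A or D to C, so a + d drops while
  c + d does not. The recursion ends in {A, C} or {C, D}. The first hypothesis rules out a power of
  C or D alone, and both new terms inherit it.\<close>

lemma so5_in_span_134:
  assumes "a \<ge> 1 \<or> c \<ge> 1 \<and> d \<ge> 1" "c + d \<ge> 2" "a + c + d \<ge> 3" "w = a + c + d"
  shows "so5_in_span (euler_sums w 2) a 0 c d"
  using assms
proof (induction "a + d" arbitrary: a c d)
  case 0
  then show ?case by simp
next
  case (Suc k)
  consider "d = 0" | "a = 0" | a' d' where "a = Suc a'" "d = Suc d'"
    by (metis not0_implies_Suc)
  then show ?case
  proof cases
    case 1
    with Suc.prems has_sum_in_span_double_term[of c a 1 1] show ?thesis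
      by (auto intro!: so5_in_span_13 simp: add.commute)
  next
    case 2
    with Suc.prems so5_in_span_34[of c d] show ?thesis by auto
  next
    case 3
    have "so5_in_span (euler_sums w 2) a' 0 (Suc c) (Suc d')"
      using 3 Suc.prems Suc.hyps(2) by (intro Suc.hyps(1)) auto
    moreover have "so5_in_span (euler_sums w 2) (Suc a') 0 (Suc c) d'"
      using 3 Suc.prems Suc.hyps(2) by (intro Suc.hyps(1)) auto
    ultimately show ?thesis unfolding 3
      by (rule so5_in_span_combine[where k = "1 / 2"])
         (simp_all only: so5_term_reduce_14, simp_all)
  qed
qed

text \<open>Here B + C = D moves exponent to D, so b + c drops until only {B, D} or {C, D} is
  left.\<close>

lemma so5_in_span_234:
  assumes "b \<ge> 1 \<or> c \<ge> 1 \<and> d \<ge> 1" "c + d \<ge> 2" "b + c + d \<ge> 3" "w = b + c + d"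
  shows "so5_in_span (euler_sums w 2) 0 b c d"
  using assms
proof (induction "b + c" arbitrary: b c d)
  case 0
  then show ?case by simp
next
  case (Suc k)
  consider "c = 0" | "b = 0" | b' c' where "b = Suc b'" "c = Suc c'"
    by (metis not0_implies_Suc)
  then show ?case
  proof cases
    case 1
    with Suc.prems has_sum_in_span_double_term[of d b 1 1]
      has_sum_in_span_double_term[of d b 1 "-1"] show ?thesis
      by (auto intro!: so5_in_span_24 simp: add.commute)
  next
    case 2
    with Suc.prems so5_in_span_34[of c d] show ?thesis by auto
  next
    case 3
    have "so5_in_span (euler_sums w 2) 0 b' (Suc c') (Suc d)"
      using 3 Suc.prems Suc.hyps(2) by (intro Suc.hyps(1)) auto
    moreover have "so5_in_span (euler_sums w 2) 0 (Suc b') c' (Suc d)"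
      using 3 Suc.prems Suc.hyps(2) by (intro Suc.hyps(1)) auto
    ultimately show ?thesis unfolding 3
      by (rule so5_in_span_combine[where k = "1"])
         (simp_all only: so5_term_reduce_23, simp_all)
  qed
qed

text \<open>A + B = C moves exponent to C until A or B is gone. At that point the matching
  convergence condition becomes c + d \<ge> 2, as the three-form lemmas require.\<close>

lemma so5_in_span_1234:
  assumes "a \<ge> 1 \<or> b \<ge> 1 \<or> c \<ge> 1 \<and> d \<ge> 1" "a + c + d \<ge> 2" "b + c + d \<ge> 2"
    "a + b + c + d \<ge> 3" "w = a + b + c + d"
  shows "so5_in_span (euler_sums w 2) a b c d"
  using assms
proof (induction "a + b" arbitrary: a b c)
  case 0
  then show ?case by (auto intro!: so5_in_span_134)
next
  case (Suc k)
  consider "a = 0" | "b = 0" | a' b' where "a = Suc a'" "b = Suc b'"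
    by (metis not0_implies_Suc)
  then show ?case
  proof cases
    case 1
    with Suc.prems show ?thesis by (auto intro!: so5_in_span_234)
  next
    case 2
    with Suc.prems show ?thesis by (auto intro!: so5_in_span_134)
  next
    case 3
    have "so5_in_span (euler_sums w 2) a' (Suc b') (Suc c) d"
      using 3 Suc.prems Suc.hyps(2) by (intro Suc.hyps(1)) auto
    moreover have "so5_in_span (euler_sums w 2) (Suc a') b' (Suc c) d"
      using 3 Suc.prems Suc.hyps(2) by (intro Suc.hyps(1)) auto
    ultimately show ?thesis unfolding 3
      by (rule so5_in_span_combine[where k = "1"])
         (simp_all only: so5_term_reduce_12, simp_all)
  qed
qed

theorem theorem1p1:
  fixes s1 s2 s3 s4 w :: nat
  assumes "s1 + s3 + s4 > 1"
    and "s2 + s3 + s4 > 1"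
    and "w = s1 + s2 + s3 + s4"
    and "w > 2"
  shows "(\<not> (s1 = 0 \<and> s2 = 0 \<and> s3 = 0) \<and> \<not> (s1 = 0 \<and> s2 = 0 \<and> s4 = 0) \<longrightarrow>
            zeta_so5 s1 s2 s3 s4 \<in> rat_real.span (euler_sums w 2)) \<and>
         ((s1 = 0 \<and> s2 = 0 \<and> s3 = 0) \<or> (s1 = 0 \<and> s2 = 0 \<and> s4 = 0) \<longrightarrow>
            zeta_so5 s1 s2 s3 s4 \<in>
              rat_real.span (insert (euler_sum [w - 1] [1]) (euler_sums w 2)))"
proof (intro conjI impI)
  assume "\<not> (s1 = 0 \<and> s2 = 0 \<and> s3 = 0) \<and> \<not> (s1 = 0 \<and> s2 = 0 \<and> s4 = 0)"
  \<comment> \<open>Excluding both special cases amounts to the disjunction in the first hypothesis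
    of \<open>so5_in_span_1234\<close>.\<close>
  with assms show "zeta_so5 s1 s2 s3 s4 \<in> rat_real.span (euler_sums w 2)"
    by (intro so5_in_span_imp_zeta_so5 so5_in_span_1234) auto
next
  let ?X = "insert (euler_sum [w - 1] [1]) (euler_sums w 2)"
  have pos: "has_sum_in_span ?X (double_term w 0 1 1) lower_pairs"
    using assms by (intro has_sum_in_span_double_term_0) auto
  have alt: "has_sum_in_span ?X (double_term w 0 1 (-1)) lower_pairs"
    using assms by (intro has_sum_in_span_mono[OF has_sum_in_span_double_term_0_alternating]) auto
  assume "(s1 = 0 \<and> s2 = 0 \<and> s3 = 0) \<or> (s1 = 0 \<and> s2 = 0 \<and> s4 = 0)"
  \<comment> \<open>A power of C alone is the {A, C} case with exponent 0 on A; a power of D alone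
    is the {B, D} case with exponent 0 on B, which also needs \<open>alt\<close>.\<close>
  then have "so5_in_span ?X s1 s2 s3 s4"
    using assms(3) so5_in_span_13[OF pos] so5_in_span_24[OF pos alt] by auto
  then show "zeta_so5 s1 s2 s3 s4 \<in> rat_real.span ?X"
    by (rule so5_in_span_imp_zeta_so5)
qed

end
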